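(* Fix $x\in\mathcal X$ and $n\in[0,b]^{|\mathcal J|}$. For a customer $j\in\mathcal J$, let $\pi$ be an ordering $\pi(0),\pi(1),\dots,\pi(|\mathcal I|)$ of $\mathcal I\cup\{0\}$ such that $c_{\pi(0)j}>c_{\pi(1)j}\ge c_{\pi(2)j}\ge\dots\ge c_{\pi(|\mathcal I|)j}\ge 0$. Suppose $\xi\sim N(\mu,\Sigma_n)$, where $\Sigma_n$ is the diagonal matrix with entries $h_j(n_j;\sigma_j)^2$. Then $$\mathbb E_{\xi_j}[R_j(x,\xi_j)] = a_{\pi(0)j}(x)+c_{\pi(0)j}\,\mu_j+h_j(n_j;\sigma_j)\sum_{k=1}^{|\mathcal I|}\left(c_{\pi(k-1)j}-c_{\pi(k)j}\right)\Psi\!\left(\frac{\hat\xi_{\pi(k)j}(x)-\mu_j}{h_j(n_j;\sigma_j)}\right),$$ where $a_{\pi(0)j}(x)=\sum_{i=1}^{|\mathcal I|}D_{\pi(i)j}\,(c_{\pi(i)j}-c_{\pi(0)j})\,x_{\pi(i)}$, $\hat\xi_{\pi(k)j}(x)=\sum_{i=k}^{|\mathcal I|}D_{\pi(i)j}\,x_{\pi(i)}$ for $k=1,\dots,|\mathcal I|$, and $\Psi(z)=z\Phi(z)+\phi(z)$ with $\Phi$ and $\phi$ the cdf and pdf of the standard normal distribution.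
   Context: $\mathcal I$ (potential facility locations) and $\mathcal J$ (customers) are finite index sets; $\mathcal X=\{x\in\{0,1\}^{|\mathcal I|}:\sum_{i\in\mathcal I}x_i\le p\}$. $c_{0j}$ is the unit penalty for unmet demand of customer $j$, $c_{ij}$ is the unit cost of serving $j$ from $i$, with $c_{0j}>c_{ij}>0$ for all $i\in\mathcal I$, $j\in\mathcal J$ (so $\pi(0)=0$); $D_{ij}\ge 0$ is the capacity of location $i$ allotted to customer $j$. The recourse cost of customer $j$ is $$R_j(x,\xi_j)=\min_{y,s}\Big\{\sum_{i\in\mathcal I}c_{ij}y_{ij}+c_{0j}s_j:\ \sum_{i\in\mathcal I}y_{ij}+s_j=\xi_j,\ 0\le y_{ij}\le D_{ij}x_i\ (i\in\mathcal I),\ s_j\ge 0\Big\}.$$ Here $\mu\in\mathbb R^{|\mathcal J|}$ is the mean demand, and the demand standard deviation $h_j(n_j;\sigma_j)$ of customer $j$ after sampling effort $n_j\ge0$, with demand-uncertainty parameter $\sigma_j$, satisfies: (i) $h_j(\cdot;\sigma_j)$ is finite, positive, strictly convex, decreasing and continuously differentiable on $[0,\infty)$ for any $\sigma_j$; (ii) $\frac{\partial h_j}{\partial\sigma_j}(n_j;\sigma_j)>0$ for all $n_j\ge0$; (iii) $\frac{\partial^2h_j}{\partial n_j\partial\sigma_j}(n_j;\sigma_j)<0$ for all $n_j\ge0$.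
   Formalization: For negative demand the minimum defining R_j(x,ξ_j) is over an empty set, and normal demand is negative with positive probability; here R_j(x,ξ_j) for ξ_j<0 is set to the smallest unit cost (over the locations and the penalty) times ξ_j. *)

theory Defs
  imports "HOL-Probability.Probability"
begin

text \<open>
  Facilities form a finite set \<open>I\<close> in a type with a distinguished element \<open>0 \<notin> I\<close>; as a first index
  of \<open>c\<close>, this \<open>0\<close> denotes unmet demand. Customers are the elements of a finite type, so that
  demand is a random vector in \<open>real ^ 'j\<close>.
\<close>

definition location_plans :: "'i set \<Rightarrow> real \<Rightarrow> ('i \<Rightarrow> real) set" where
  "location_plans I p = {x. (\<forall>i\<in>I. x i \<in> {0, 1}) \<and> (\<Sum>i\<in>I. x i) \<le> p}"

definition recourse_feasible ::
  "'i set \<Rightarrow> ('i \<Rightarrow> 'j \<Rightarrow> real) \<Rightarrow> 'j \<Rightarrow> ('i \<Rightarrow> real) \<Rightarrow> real \<Rightarrow> (('i \<Rightarrow> real) \<times> real) set" where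
  "recourse_feasible I D j x d =
     {(y, s). (\<Sum>i\<in>I. y i) + s = d \<and> (\<forall>i\<in>I. 0 \<le> y i \<and> y i \<le> D i j * x i) \<and> 0 \<le> s}"

definition recourse_lp ::
  "'i::zero set \<Rightarrow> ('i \<Rightarrow> 'j \<Rightarrow> real) \<Rightarrow> ('i \<Rightarrow> 'j \<Rightarrow> real) \<Rightarrow> 'j \<Rightarrow> ('i \<Rightarrow> real) \<Rightarrow> real \<Rightarrow> real" where
  "recourse_lp I c D j x d =
     (INF (y, s)\<in>recourse_feasible I D j x d. (\<Sum>i\<in>I. c i j * y i) + c 0 j * s)"

lemma recourse_feasible_nonempty_iff:
  assumes "finite I" "\<forall>i\<in>I. 0 \<le> D i j" "x \<in> location_plans I p"
  shows "recourse_feasible I D j x d \<noteq> {} \<longleftrightarrow> 0 \<le> d"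
proof
  assume "recourse_feasible I D j x d \<noteq> {}"
  then obtain y s where "(\<Sum>i\<in>I. y i) + s = d" "\<forall>i\<in>I. 0 \<le> y i" "0 \<le> s"
    by (auto simp: recourse_feasible_def)
  moreover from this have "0 \<le> (\<Sum>i\<in>I. y i)"
    by (intro sum_nonneg) auto
  ultimately show "0 \<le> d"
    by linarith
next
  assume "0 \<le> d"
  moreover have "\<forall>i\<in>I. 0 \<le> x i"
    using assms(3) by (force simp: location_plans_def)
  ultimately have "((\<lambda>_. 0), d) \<in> recourse_feasible I D j x d"
    using assms(2) by (auto simp: recourse_feasible_def)
  then show "recourse_feasible I D j x d \<noteq> {}"
    by blast
qed

text \<open>
  The linear program is infeasible exactly for negative demand, which a normally distributed demand
  takes with positive probability: without a convention the expected recourse cost is not a real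
  number. As is implicit in the closed form for normal demand, negative demand is credited at the
  smallest unit cost.
\<close>

definition recourse ::
  "'i::zero set \<Rightarrow> ('i \<Rightarrow> 'j \<Rightarrow> real) \<Rightarrow> ('i \<Rightarrow> 'j \<Rightarrow> real) \<Rightarrow> 'j \<Rightarrow> ('i \<Rightarrow> real) \<Rightarrow> real \<Rightarrow> real" where
  "recourse I c D j x d =
     (if 0 \<le> d then recourse_lp I c D j x d else Min ((\<lambda>i. c i j) ` insert 0 I) * d)"

definition cost_ordering ::
  "'i::zero set \<Rightarrow> ('i \<Rightarrow> 'j \<Rightarrow> real) \<Rightarrow> 'j \<Rightarrow> (nat \<Rightarrow> 'i) \<Rightarrow> bool" where
  "cost_ordering I c j \<pi> \<longleftrightarrow>
     bij_betw \<pi> {0..card I} (insert 0 I) \<and>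
     (1 \<le> card I \<longrightarrow> c (\<pi> 0) j > c (\<pi> 1) j) \<and>
     (\<forall>k\<in>{1..<card I}. c (\<pi> k) j \<ge> c (\<pi> (k + 1)) j) \<and>
     c (\<pi> (card I)) j \<ge> 0"

definition base_cost ::
  "'i set \<Rightarrow> ('i \<Rightarrow> 'j \<Rightarrow> real) \<Rightarrow> ('i \<Rightarrow> 'j \<Rightarrow> real) \<Rightarrow> 'j \<Rightarrow> (nat \<Rightarrow> 'i) \<Rightarrow> ('i \<Rightarrow> real) \<Rightarrow> real" where
  "base_cost I c D j \<pi> x =
     (\<Sum>i=1..card I. D (\<pi> i) j * (c (\<pi> i) j - c (\<pi> 0) j) * x (\<pi> i))"

definition breakpoint ::
  "'i set \<Rightarrow> ('i \<Rightarrow> 'j \<Rightarrow> real) \<Rightarrow> 'j \<Rightarrow> (nat \<Rightarrow> 'i) \<Rightarrow> ('i \<Rightarrow> real) \<Rightarrow> nat \<Rightarrow> real" where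
  "breakpoint I D j \<pi> x k = (\<Sum>i=k..card I. D (\<pi> i) j * x (\<pi> i))"

definition strictly_convex_on :: "real set \<Rightarrow> (real \<Rightarrow> real) \<Rightarrow> bool" where
  "strictly_convex_on A f \<longleftrightarrow> convex A \<and>
     (\<forall>u\<in>A. \<forall>v\<in>A. \<forall>t. u \<noteq> v \<and> 0 < t \<and> t < 1 \<longrightarrow>
        f ((1 - t) * u + t * v) < (1 - t) * f u + t * f v)"

text \<open>
  \<open>f m s\<close> is the standard deviation after sampling effort \<open>m\<close> under uncertainty parameter \<open>s\<close>, and
  \<open>S\<close> is the (open) range of admissible parameters. Derivatives in \<open>m\<close> are relative to \<open>[0, \<infinity>)\<close>,
  hence one-sided at \<open>0\<close>; \<open>fms\<close> is the \<open>m\<close>-derivative of the \<open>s\<close>-derivative \<open>fs\<close>.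
\<close>

definition std_dev_model :: "real set \<Rightarrow> (real \<Rightarrow> real \<Rightarrow> real) \<Rightarrow> bool" where
  "std_dev_model S f \<longleftrightarrow> open S \<and>
     (\<forall>s\<in>S.
        (\<forall>m\<ge>0. 0 < f m s) \<and>
        strictly_convex_on {0..} (\<lambda>m. f m s) \<and>
        antimono_on {0..} (\<lambda>m. f m s) \<and>
        (\<exists>fm. continuous_on {0..} fm \<and>
           (\<forall>m\<ge>0. ((\<lambda>m. f m s) has_real_derivative fm m) (at m within {0..})))) \<and>
     (\<exists>fs fms. \<forall>s\<in>S. \<forall>m\<ge>0.
        ((\<lambda>s. f m s) has_real_derivative fs m s) (at s) \<and> 0 < fs m s \<and>
        ((\<lambda>m. fs m s) has_real_derivative fms m s) (at m within {0..}) \<and> fms m s < 0)"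

text \<open>A normal law of variance \<open>0\<close> is a point mass.\<close>

definition has_normal_law :: "'a measure \<Rightarrow> ('a \<Rightarrow> real) \<Rightarrow> real \<Rightarrow> real \<Rightarrow> bool" where
  "has_normal_law M Y m v \<longleftrightarrow> 0 \<le> v \<and> Y \<in> borel_measurable M \<and>
     (if v = 0 then AE \<omega> in M. Y \<omega> = m
      else distributed M lborel Y (normal_density m (sqrt v)))"

text \<open>A random vector is normal iff all its linear functionals are.\<close>

definition has_multivariate_normal_law ::
  "'a measure \<Rightarrow> ('a \<Rightarrow> real ^ 'j) \<Rightarrow> real ^ 'j \<Rightarrow> real ^ 'j ^ 'j \<Rightarrow> bool" where
  "has_multivariate_normal_law M X \<mu> V \<longleftrightarrow>
     X \<in> borel_measurable M \<and> transpose V = V \<and>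
     (\<forall>u. has_normal_law M (\<lambda>\<omega>. u \<bullet> X \<omega>) (u \<bullet> \<mu>) (u \<bullet> (V *v u)))"

definition demand_covariance ::
  "('j \<Rightarrow> real \<Rightarrow> real \<Rightarrow> real) \<Rightarrow> real ^ 'j \<Rightarrow> real ^ 'j \<Rightarrow> real ^ 'j ^ 'j" where
  "demand_covariance h \<sigma> n = (\<chi> j k. if j = k then (h j (n $ j) (\<sigma> $ j))\<^sup>2 else 0)"

definition std_normal_cdf :: "real \<Rightarrow> real" where
  "std_normal_cdf z = cdf std_normal_distribution z"

definition normal_loss :: "real \<Rightarrow> real" where
  "normal_loss z = z * std_normal_cdf z + std_normal_density z"

end

theory Submission
  imports Defs
begin

text \<open>
  Compared with leaving all demand unmet, the cost of serving demand \<open>d\<close> is \<open>c\<^sub>0 d\<close> minus the savings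
  \<open>\<Sum>i. (c\<^sub>0 - c\<^sub>i) y\<^sub>i\<close>. Along the ordering \<open>\<pi>\<close>, from the most to the least expensive source, Abel
  summation turns the savings into
  \<open>\<Sum>k. (c\<^bsub>\<pi>(k-1)\<^esub> - c\<^bsub>\<pi>(k)\<^esub>) T\<^sub>k\<close>, where \<open>T\<^sub>k\<close> is the amount delivered by the sources \<open>\<pi>(k), \<dots>\<close>,
  that is, by the cheap end of the list. All weights are nonnegative, and \<open>T\<^sub>k\<close> exceeds neither the
  capacity \<open>B\<^sub>k\<close> of these sources (the \<open>k\<close>-th breakpoint) nor \<open>d\<close>. Filling the cheapest sources first
  attains \<open>T\<^sub>k = min B\<^sub>k d\<close> for all \<open>k\<close> at once, so (\<open>recourse_lp_eq_min_breakpoints\<close>) the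
  recourse cost is \<open>c\<^sub>0 d - (\<Sum>k. (c\<^bsub>\<pi>(k-1)\<^esub> - c\<^bsub>\<pi>(k)\<^esub>) min B\<^sub>k d)\<close>.

  The breakpoints are nonnegative, so for negative \<open>d\<close> every minimum is \<open>d\<close>, the sum telescopes, and
  the same formula gives the smallest unit cost times \<open>d\<close>, which is the convention for negative
  demand. Hence the formula holds for all real \<open>d\<close> (\<open>recourse_eq_min_breakpoints\<close>), and the
  expectation reduces to that of \<open>min B Y = B - max 0 (B - Y)\<close> for a normal \<open>Y\<close>. The expectation of
  the last term is a multiple of the loss function \<open>\<Psi>\<close> (\<open>normal_expected_min\<close>), by standardization
  and because the density \<open>\<phi>\<close> satisfies \<open>\<phi>' t = - t \<phi> t\<close>. Weighted by the cost drops, the constants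
  \<open>B\<^sub>k\<close> add up to minus the base cost, again by Abel summation.
\<close>

section \<open>The recourse cost as a piecewise linear function of demand\<close>

text \<open>
  Abel summation: each total drop \<open>\<gamma> 0 - \<gamma> i\<close> is the sum of the single drops up to \<open>i\<close>, so the drop at
  \<open>k\<close> collects the weights from \<open>k\<close> on.
\<close>

lemma sum_drops_eq_sum_tails:
  fixes \<gamma> w :: "nat \<Rightarrow> real"
  shows "(\<Sum>i=1..m. (\<gamma> 0 - \<gamma> i) * w i) =
    (\<Sum>k=1..m. (\<gamma> (k - 1) - \<gamma> k) * (\<Sum>i=k..m. w i))"
proof (induction m)
  case 0
  show ?case by simp
next
  case (Suc m)
  have tele: "(\<Sum>k=1..m. \<gamma> (k - 1) - \<gamma> k) = \<gamma> 0 - \<gamma> m"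
    by (induction m) auto
  have "(\<Sum>k=1..m. (\<gamma> (k - 1) - \<gamma> k) * (\<Sum>i=k..Suc m. w i)) =
      (\<Sum>k=1..m. (\<gamma> (k - 1) - \<gamma> k) * (\<Sum>i=k..m. w i)) + (\<gamma> 0 - \<gamma> m) * w (Suc m)"
    unfolding tele[symmetric] sum_distrib_right sum.distrib[symmetric]
    by (intro sum.cong) (auto simp: algebra_simps)
  then show ?case
    using Suc.IH by (simp add: algebra_simps)
qed

text \<open>
  The position of the penalty is forced: its cost strictly exceeds every service cost, and the costs
  do not increase along the ordering.
\<close>

lemma cost_ordering_zero:
  assumes "finite I" "0 \<notin> I" "\<forall>i\<in>I. c i j < c 0 j" "cost_ordering I c j \<pi>"
  shows "\<pi> 0 = 0"
proof (rule ccontr)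
  assume ne: "\<pi> 0 \<noteq> 0"
  have bij: "bij_betw \<pi> {0..card I} (insert 0 I)"
    using assms(4) by (simp add: cost_ordering_def)
  obtain k where k: "k \<le> card I" "\<pi> k = 0"
    using bij by (metis atLeastAtMost_iff bij_betw_imp_surj_on imageE insertI1)
  have "k \<noteq> 0" using ne k by metis
  have "c (\<pi> l) j \<le> c (\<pi> 1) j" if "1 \<le> l" "l \<le> card I" for l
    using that
  proof (induction l rule: dec_induct)
    case (step l)
    have "c (\<pi> (l + 1)) j \<le> c (\<pi> l) j"
      using assms(4) step by (auto simp: cost_ordering_def)
    then show ?case using step by simp
  qed simp
  then have "c 0 j \<le> c (\<pi> 1) j"
    using k \<open>k \<noteq> 0\<close> by (metis One_nat_def Suc_leI neq0_conv)
  moreover have "c (\<pi> 1) j < c (\<pi> 0) j"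
    using assms(4) k \<open>k \<noteq> 0\<close> by (auto simp: cost_ordering_def)
  moreover have "\<pi> 0 \<in> I"
    using bij ne by (metis atLeastAtMost_iff bij_betwE insertE le0)
  then have "c (\<pi> 0) j < c 0 j"
    using assms(3) by simp
  ultimately show False by simp
qed

lemma cost_ordering_bij_facilities:
  assumes "0 \<notin> I" "cost_ordering I c j \<pi>" "\<pi> 0 = 0"
  shows "bij_betw \<pi> {1..card I} I"
proof -
  have "bij_betw \<pi> ({0..card I} - {0}) (insert 0 I - {0})"
    using assms by (intro bij_betw_DiffI) (auto simp: cost_ordering_def bij_betw_def)
  moreover have "{0..card I} - {0} = {1..card I}" "insert 0 I - {0} = I"
    using assms(1) by auto
  ultimately show ?thesis by simp
qed

lemma cost_ordering_drop_nonneg: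
  assumes "cost_ordering I c j \<pi>" "k \<in> {1..card I}"
  shows "0 \<le> c (\<pi> (k - 1)) j - c (\<pi> k) j"
proof (cases "k = 1")
  case True
  then show ?thesis using assms by (auto simp: cost_ordering_def)
next
  case False
  then have "k - 1 \<in> {1..<card I}" "k - 1 + 1 = k"
    using assms(2) by auto
  then show ?thesis
    using assms(1) unfolding cost_ordering_def by (metis diff_ge_0_iff_ge)
qed

lemma Min_cost_eq_last:
  assumes "finite I" "cost_ordering I c j \<pi>"
  shows "Min ((\<lambda>i. c i j) ` insert 0 I) = c (\<pi> (card I)) j"
proof (rule Min_eqI)
  have bij: "bij_betw \<pi> {0..card I} (insert 0 I)"
    using assms(2) by (simp add: cost_ordering_def)
  then have "\<pi> (card I) \<in> insert 0 I"
    by (rule bij_betw_apply) simp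
  then show "c (\<pi> (card I)) j \<in> (\<lambda>i. c i j) ` insert 0 I"
    by (rule imageI)
  fix v assume "v \<in> (\<lambda>i. c i j) ` insert 0 I"
  then obtain l where l: "l \<le> card I" "v = c (\<pi> l) j"
    using bij unfolding bij_betw_def
    by (metis (no_types, lifting) atLeastAtMost_iff imageE)
  have "c (\<pi> (card I)) j \<le> c (\<pi> l) j"
    using l(1)
  proof (induction l rule: inc_induct)
    case (step l)
    then show ?case
      using cost_ordering_drop_nonneg[OF assms(2), of "Suc l"] by auto
  qed simp
  then show "c (\<pi> (card I)) j \<le> v" using l by simp
qed (use assms in simp)

text \<open>
  The cost of any balanced plan is the penalty for the whole demand minus the savings, grouped by
  the amounts delivered by the cheapest sources.
\<close>

lemma service_cost_eq:
  fixes c :: "'i::zero \<Rightarrow> 'j \<Rightarrow> real"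
  assumes bij: "bij_betw \<pi> {1..card I} I" and "\<pi> 0 = 0" and "(\<Sum>i\<in>I. y i) + s = d"
  shows "(\<Sum>i\<in>I. c i j * y i) + c 0 j * s =
    c (\<pi> 0) j * d -
      (\<Sum>k=1..card I. (c (\<pi> (k - 1)) j - c (\<pi> k) j) * (\<Sum>i=k..card I. y (\<pi> i)))"
proof -
  have "(\<Sum>i\<in>I. (c 0 j - c i j) * y i) =
      (\<Sum>k=1..card I. (c (\<pi> 0) j - c (\<pi> k) j) * y (\<pi> k))"
    using sum.reindex_bij_betw[OF bij, of "\<lambda>i. (c 0 j - c i j) * y i"] assms(2) by simp
  also have "\<dots> =
      (\<Sum>k=1..card I. (c (\<pi> (k - 1)) j - c (\<pi> k) j) * (\<Sum>i=k..card I. y (\<pi> i)))"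
    by (rule sum_drops_eq_sum_tails[of "\<lambda>k. c (\<pi> k) j"])
  finally have "(\<Sum>k=1..card I. (c (\<pi> (k - 1)) j - c (\<pi> k) j) * (\<Sum>i=k..card I. y (\<pi> i))) =
      (\<Sum>i\<in>I. (c 0 j - c i j) * y i)" ..
  also have "\<dots> = c 0 j * (\<Sum>i\<in>I. y i) - (\<Sum>i\<in>I. c i j * y i)"
    by (simp add: sum_distrib_left sum_subtractf left_diff_distrib)
  finally show ?thesis
    using assms(2,3) by (auto simp: algebra_simps)
qed

lemma breakpoint_split:
  "k \<le> card I \<Longrightarrow> breakpoint I D j \<pi> x k = D (\<pi> k) j * x (\<pi> k) + breakpoint I D j \<pi> x (Suc k)"
  by (simp add: breakpoint_def sum.atLeast_Suc_atMost)

lemma breakpoint_last [simp]: "breakpoint I D j \<pi> x (Suc (card I)) = 0"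
  by (simp add: breakpoint_def)

lemma sum_min_breakpoint_diff:
  assumes "k \<le> Suc (card I)" "0 \<le> d"
  shows "(\<Sum>i=k..card I. min (breakpoint I D j \<pi> x i) d - min (breakpoint I D j \<pi> x (Suc i)) d) =
    min (breakpoint I D j \<pi> x k) d"
  using assms(1)
proof (induction k rule: inc_induct)
  case (step k)
  then show ?case by (simp add: sum.atLeast_Suc_atMost)
qed (use assms(2) in simp)

text \<open>
  Any feasible plan delivers at most \<open>min B\<^sub>k d\<close> from the sources \<open>\<pi>(k), \<dots>\<close>, and all cost drops are
  nonnegative, so the right-hand side is a lower bound. Serving greedily from the cheapest available
  source makes all these bounds tight simultaneously.
\<close>

lemma recourse_lp_eq_min_breakpoints:
  assumes "finite I" "0 \<notin> I" "\<forall>i\<in>I. c i j < c 0 j" "\<forall>i\<in>I. 0 \<le> D i j"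
    and "x \<in> location_plans I p" "cost_ordering I c j \<pi>" "0 \<le> d"
  shows "recourse_lp I c D j x d =
    c (\<pi> 0) j * d -
      (\<Sum>k=1..card I. (c (\<pi> (k - 1)) j - c (\<pi> k) j) * min (breakpoint I D j \<pi> x k) d)"
    (is "_ = ?V")
proof -
  have \<pi>0: "\<pi> 0 = 0"
    using assms by (intro cost_ordering_zero) auto
  note bij = cost_ordering_bij_facilities[OF assms(2,6) \<pi>0]
  have \<pi>_in: "\<pi> i \<in> I" if "1 \<le> i" "i \<le> card I" for i
    using bij that by (auto dest!: bij_betwE)
  let ?B = "breakpoint I D j \<pi> x"
  show ?thesis
    unfolding recourse_lp_def
  proof (rule cInf_eq_minimum)
    fix v
    assume "v \<in> (\<lambda>(y, s). (\<Sum>i\<in>I. c i j * y i) + c 0 j * s) ` recourse_feasible I D j x d"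
    then obtain y s where v: "v = (\<Sum>i\<in>I. c i j * y i) + c 0 j * s"
      and bal: "(\<Sum>i\<in>I. y i) + s = d" and s: "0 \<le> s"
      and y: "\<And>i. i \<in> I \<Longrightarrow> 0 \<le> y i" "\<And>i. i \<in> I \<Longrightarrow> y i \<le> D i j * x i"
      by (auto simp: recourse_feasible_def)
    have tail: "(\<Sum>i=k..card I. y (\<pi> i)) \<le> min (?B k) d" if k: "k \<in> {1..card I}" for k
    proof (rule min.boundedI)
      show "(\<Sum>i=k..card I. y (\<pi> i)) \<le> ?B k"
        unfolding breakpoint_def using k y(2) \<pi>_in by (intro sum_mono) auto
      have "(\<Sum>i=k..card I. y (\<pi> i)) \<le> (\<Sum>i=1..card I. y (\<pi> i))"
        using k y(1) \<pi>_in by (intro sum_mono2) auto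
      also have "\<dots> = (\<Sum>i\<in>I. y i)"
        by (rule sum.reindex_bij_betw[OF bij])
      finally show "(\<Sum>i=k..card I. y (\<pi> i)) \<le> d"
        using bal s by simp
    qed
    have "(\<Sum>k=1..card I. (c (\<pi> (k - 1)) j - c (\<pi> k) j) * (\<Sum>i=k..card I. y (\<pi> i))) \<le>
        (\<Sum>k=1..card I. (c (\<pi> (k - 1)) j - c (\<pi> k) j) * min (?B k) d)"
      using tail cost_ordering_drop_nonneg[OF assms(6)]
      by (intro sum_mono mult_left_mono) auto
    then show "?V \<le> v"
      unfolding v service_cost_eq[OF bij \<pi>0 bal] by simp
  next
    \<comment> \<open>the tail sums of the greedy plan must be \<open>min (?B k) d\<close>, which determines its entries\<close>
    define y where "y i = (let k = inv_into {1..card I} \<pi> i in min (?B k) d - min (?B (Suc k)) d)" for i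
    define s where "s = d - min (?B 1) d"
    have y_\<pi>: "y (\<pi> k) = min (?B k) d - min (?B (Suc k)) d" if "k \<in> {1..card I}" for k
      using bij that by (simp add: y_def bij_betw_def)
    have tail: "(\<Sum>i=k..card I. y (\<pi> i)) = min (?B k) d" if "1 \<le> k" "k \<le> Suc (card I)" for k
    proof -
      have "(\<Sum>i=k..card I. y (\<pi> i)) = (\<Sum>i=k..card I. min (?B i) d - min (?B (Suc i)) d)"
        using that y_\<pi> by (intro sum.cong) auto
      then show ?thesis
        using sum_min_breakpoint_diff[OF that(2) assms(7)] by simp
    qed
    have bal: "(\<Sum>i\<in>I. y i) + s = d"
      using sum.reindex_bij_betw[OF bij, of y] tail[of 1] by (simp add: s_def)
    have cap: "0 \<le> y i \<and> y i \<le> D i j * x i" if "i \<in> I" for i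
    proof -
      obtain k where k: "k \<in> {1..card I}" "i = \<pi> k"
        using bij \<open>i \<in> I\<close> by (metis bij_betw_def imageE)
      have "0 \<le> x i"
        using assms(5) \<open>i \<in> I\<close> by (force simp: location_plans_def)
      then have "0 \<le> D i j * x i"
        using assms(4) \<open>i \<in> I\<close> by simp
      moreover have "?B k = D i j * x i + ?B (Suc k)"
        using k by (simp add: breakpoint_split)
      ultimately show ?thesis
        using y_\<pi>[OF k(1)] k(2) by auto
    qed
    have "(y, s) \<in> recourse_feasible I D j x d"
      using bal cap by (auto simp: recourse_feasible_def s_def)
    moreover have "?V = (\<Sum>i\<in>I. c i j * y i) + c 0 j * s"
      unfolding service_cost_eq[OF bij \<pi>0 bal] using tail by simp
    ultimately show "?V \<in>
        (\<lambda>(y, s). (\<Sum>i\<in>I. c i j * y i) + c 0 j * s) ` recourse_feasible I D j x d"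
      by (metis (mono_tags, lifting) case_prod_conv image_eqI)
  qed
qed

text \<open>
  The formula persists for negative demand: such a demand lies below all breakpoints, and the sum of
  the cost drops telescopes to leave only the smallest cost.
\<close>

lemma recourse_eq_min_breakpoints:
  assumes "finite I" "0 \<notin> I" "\<forall>i\<in>I. c i j < c 0 j" "\<forall>i\<in>I. 0 \<le> D i j"
    and "x \<in> location_plans I p" "cost_ordering I c j \<pi>"
  shows "recourse I c D j x d =
    c (\<pi> 0) j * d -
      (\<Sum>k=1..card I. (c (\<pi> (k - 1)) j - c (\<pi> k) j) * min (breakpoint I D j \<pi> x k) d)"
proof (cases "0 \<le> d")
  case True
  then show ?thesis
    using recourse_lp_eq_min_breakpoints[where c = c and D = D, OF assms True] by (simp add: recourse_def)
next
  case False
  have \<pi>0: "\<pi> 0 = 0"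
    using assms by (intro cost_ordering_zero) auto
  note bij = cost_ordering_bij_facilities[OF assms(2,6) \<pi>0]
  have "0 \<le> breakpoint I D j \<pi> x k" if "k \<in> {1..card I}" for k
    unfolding breakpoint_def
  proof (intro sum_nonneg mult_nonneg_nonneg)
    fix i assume "i \<in> {k..card I}"
    then have "\<pi> i \<in> I"
      using bij that by (auto dest!: bij_betwE)
    then show "0 \<le> D (\<pi> i) j" "0 \<le> x (\<pi> i)"
      using assms(4,5) by (force simp: location_plans_def)+
  qed
  then have "(\<Sum>k=1..card I. (c (\<pi> (k - 1)) j - c (\<pi> k) j) * min (breakpoint I D j \<pi> x k) d) =
      (\<Sum>k=1..card I. (c (\<pi> (k - 1)) j - c (\<pi> k) j) * d)"
    using False by (intro sum.cong refl) (force simp: min_def)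
  also have "\<dots> = (c (\<pi> 0) j - c (\<pi> (card I)) j) * d"
  proof -
    have "(\<Sum>k=1..m. c (\<pi> (k - 1)) j - c (\<pi> k) j) = c (\<pi> 0) j - c (\<pi> m) j" for m
      by (induction m) auto
    then show ?thesis by (simp add: sum_distrib_right[symmetric])
  qed
  finally show ?thesis
    using False Min_cost_eq_last[OF assms(1,6)] by (simp add: recourse_def algebra_simps)
qed

lemma base_cost_eq_breakpoints:
  "base_cost I c D j \<pi> x =
    - (\<Sum>k=1..card I. (c (\<pi> (k - 1)) j - c (\<pi> k) j) * breakpoint I D j \<pi> x k)"
proof -
  have "base_cost I c D j \<pi> x =
      - (\<Sum>k=1..card I. (c (\<pi> 0) j - c (\<pi> k) j) * (D (\<pi> k) j * x (\<pi> k)))"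
    unfolding base_cost_def sum_negf[symmetric] by (intro sum.cong) (auto simp: algebra_simps)
  then show ?thesis
    unfolding breakpoint_def sum_drops_eq_sum_tails[of "\<lambda>k. c (\<pi> k) j"] by simp
qed

section \<open>The expected minimum of a constant and a normal variable\<close>

lemma std_normal_density_tendsto_at_bot: "(std_normal_density \<longlongrightarrow> 0) at_bot"
proof -
  have "filterlim (\<lambda>t::real. t\<^sup>2) at_top at_bot"
    by (rule filterlim_pow_at_bot_even) (auto simp: filterlim_ident)
  then have "filterlim (\<lambda>t::real. - t\<^sup>2 / 2) at_bot at_bot"
    by (auto simp: filterlim_uminus_at_bot field_simps
        intro!: filterlim_tendsto_pos_mult_at_top[of "\<lambda>_. 1 / 2" "1 / 2", simplified])
  then have "((\<lambda>t::real. (1 / sqrt (2 * pi)) * exp (- t\<^sup>2 / 2)) \<longlongrightarrow> (1 / sqrt (2 * pi)) * 0) at_bot"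
    by (intro tendsto_mult tendsto_const filterlim_compose[OF exp_at_bot])
  then show ?thesis
    by (simp add: std_normal_density_def[abs_def])
qed

text \<open>The integrand is the derivative of \<open>- \<phi>\<close>, and \<open>\<phi>\<close> vanishes at \<open>-\<infinity>\<close>.\<close>

lemma integral_atMost_std_normal_moment:
  "(LBINT t:{..z}. t * std_normal_density t) = - std_normal_density z"
proof -
  have int: "integrable lborel (\<lambda>t. t * std_normal_density t)"
    using integrable_std_normal_moment[of 1] by (simp add: mult.commute)
  have lim: "(std_normal_density \<longlongrightarrow> std_normal_density z) (at_left z)"
    unfolding std_normal_density_def by (intro tendsto_intros) auto
  have "(LBINT t=-\<infinity>..z. t * std_normal_density t) = - std_normal_density z - (- 0)"
  proof (rule interval_integral_FTC_integrable)
    show "((\<lambda>t. - std_normal_density t) has_vector_derivative t * std_normal_density t) (at t)" for t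
      unfolding std_normal_density_def has_real_derivative_iff_has_vector_derivative[symmetric]
      by (auto intro!: derivative_eq_intros simp: real_div_sqrt field_simps)
    show "isCont (\<lambda>t. t * std_normal_density t) t" for t
      unfolding std_normal_density_def by (intro continuous_intros) auto
    show "set_integrable lborel (einterval (- \<infinity>) (ereal z)) (\<lambda>t. t * std_normal_density t)"
      unfolding set_integrable_def by (rule integrable_mult_indicator[OF _ int]) simp
    show "(((\<lambda>t. - std_normal_density t) \<circ> real_of_ereal) \<longlongrightarrow> - 0) (at_right (- \<infinity>))"
      using tendsto_minus[OF std_normal_density_tendsto_at_bot] by (simp add: ereal_tendsto_simps)
    show "(((\<lambda>t. - std_normal_density t) \<circ> real_of_ereal) \<longlongrightarrow> - std_normal_density z)
        (at_left (ereal z))"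
      using tendsto_minus[OF lim] by (simp add: ereal_tendsto_simps)
  qed simp
  moreover have "(LBINT t=-\<infinity>..z. t * std_normal_density t) =
      (LBINT t:{..z}. t * std_normal_density t)"
  proof -
    have "({..<z} - {..z}) \<union> ({..z} - {..<z}) = {z}"
      by auto
    then have "(LBINT t:{..<z}. t * std_normal_density t) = (LBINT t:{..z}. t * std_normal_density t)"
      by (intro set_integral_null_delta[OF int]) (simp_all add: null_sets_def)
    then show ?thesis
      by (simp add: interval_lebesgue_integral_def)
  qed
  ultimately show ?thesis by simp
qed

text \<open>
  On \<open>t \<le> z\<close> the integrand is \<open>z \<phi> t - t \<phi> t\<close>; the two parts contribute the two summands of \<open>\<Psi> z\<close>.
\<close>

lemma std_normal_expected_shortfall:
  shows "integrable lborel (\<lambda>t. std_normal_density t * max 0 (z - t))"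
    and "(\<integral>t. std_normal_density t * max 0 (z - t) \<partial>lborel) = normal_loss z"
proof -
  have eq: "std_normal_density t * max 0 (z - t) =
      z * (indicator {..z} t * std_normal_density t) -
      indicator {..z} t * (t * std_normal_density t)" for t
    by (auto simp: indicator_def algebra_simps)
  have i1: "integrable lborel (\<lambda>t. indicator {..z} t * std_normal_density t)"
    using integrable_mult_indicator[of "{..z}" lborel std_normal_density] by simp
  have "integrable lborel (\<lambda>t. t * std_normal_density t)"
    using integrable_std_normal_moment[of 1] by (simp add: mult.commute)
  then have i2: "integrable lborel (\<lambda>t. indicator {..z} t * (t * std_normal_density t))"
    using integrable_mult_indicator[of "{..z}" lborel "\<lambda>t. t * std_normal_density t"] by simp
  show "integrable lborel (\<lambda>t. std_normal_density t * max 0 (z - t))"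
    unfolding eq using i1 i2 by simp
  interpret real_distribution std_normal_distribution
    by (rule real_dist_normal_dist)
  have "std_normal_cdf z = (\<integral>t. indicator {..z} t \<partial>std_normal_distribution)"
    by (simp add: std_normal_cdf_def cdf_def)
  also have "\<dots> = (\<integral>t. std_normal_density t * indicator {..z} t \<partial>lborel)"
    by (subst integral_density) auto
  finally have "(\<integral>t. indicator {..z} t * std_normal_density t \<partial>lborel) = std_normal_cdf z"
    by (simp add: mult.commute)
  then show "(\<integral>t. std_normal_density t * max 0 (z - t) \<partial>lborel) = normal_loss z"
    unfolding eq using i1 i2 integral_atMost_std_normal_moment[of z]
    by (simp add: normal_loss_def set_lebesgue_integral_def)
qed

text \<open>Standardizing \<open>Y\<close> turns the shortfall of \<open>Y\<close> below \<open>B\<close> into that of a standard normal variable.\<close>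

lemma (in prob_space) normal_expected_min:
  assumes Y: "distributed M lborel Y (normal_density m \<tau>)" and \<tau>: "0 < \<tau>"
  shows "integrable M (\<lambda>\<omega>. min B (Y \<omega>))"
    and "expectation (\<lambda>\<omega>. min B (Y \<omega>)) = B - \<tau> * normal_loss ((B - m) / \<tau>)"
proof -
  let ?z = "(B - m) / \<tau>" and ?Z = "\<lambda>\<omega>. (Y \<omega> - m) / \<tau>"
  have Z: "distributed M lborel ?Z std_normal_density"
    using Y normal_standard_normal_convert[OF \<tau>] by simp
  have eq: "min B (Y \<omega>) = B - \<tau> * max 0 (?z - ?Z \<omega>)" for \<omega>
    using \<tau> by (auto simp: min_def max_def field_simps)
  have int: "integrable M (\<lambda>\<omega>. max 0 (?z - ?Z \<omega>))"
    using distributed_integrable[OF Z, of "\<lambda>t. max 0 (?z - t)"] std_normal_expected_shortfall(1)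
    by simp
  have "expectation (\<lambda>\<omega>. max 0 (?z - ?Z \<omega>)) = normal_loss ?z"
    using distributed_integral[OF Z, of "\<lambda>t. max 0 (?z - t)"] std_normal_expected_shortfall(2)[of ?z]
    by simp
  with int show "integrable M (\<lambda>\<omega>. min B (Y \<omega>))"
    and "expectation (\<lambda>\<omega>. min B (Y \<omega>)) = B - \<tau> * normal_loss ?z"
    unfolding eq by (simp_all add: prob_space)
qed

section \<open>The expected recourse cost\<close>

text \<open>
  Joint normality is applied to the coordinate functional \<open>axis j 1\<close>, for which the quadratic form of
  the diagonal covariance matrix is its \<open>j\<close>-th entry.
\<close>

lemma demand_component_normal:
  assumes "has_multivariate_normal_law M \<xi> \<mu> (demand_covariance h \<sigma> n)"
    and "0 < h j (n $ j) (\<sigma> $ j)"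
  shows "distributed M lborel (\<lambda>\<omega>. \<xi> \<omega> $ j) (normal_density (\<mu> $ j) (h j (n $ j) (\<sigma> $ j)))"
proof -
  let ?e = "axis j 1 :: real ^ 'b"
  have "?e \<bullet> (demand_covariance h \<sigma> n *v ?e) = (h j (n $ j) (\<sigma> $ j))\<^sup>2"
    by (simp add: inner_axis' matrix_vector_mul_component demand_covariance_def inner_axis)
  moreover have "has_normal_law M (\<lambda>\<omega>. ?e \<bullet> \<xi> \<omega>) (?e \<bullet> \<mu>) (?e \<bullet> (demand_covariance h \<sigma> n *v ?e))"
    using assms(1) by (simp add: has_multivariate_normal_law_def)
  ultimately show ?thesis
    using assms(2) by (simp add: has_normal_law_def inner_axis')
qed

theorem proposition1:
  fixes I :: "'i::zero set"
    and c D :: "'i \<Rightarrow> 'j::finite \<Rightarrow> real"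
    and h :: "'j \<Rightarrow> real \<Rightarrow> real \<Rightarrow> real"
    and S :: "'j \<Rightarrow> real set"
    and \<mu> \<sigma> n :: "real ^ 'j"
    and p b :: real
    and x :: "'i \<Rightarrow> real"
    and j :: 'j
    and \<pi> :: "nat \<Rightarrow> 'i"
    and M :: "'a measure"
    and \<xi> :: "'a \<Rightarrow> real ^ 'j"
  assumes "finite I" and "0 \<notin> I"
    and "\<forall>i\<in>I. \<forall>j. c 0 j > c i j \<and> c i j > 0"
    and "\<forall>i\<in>I. \<forall>j. D i j \<ge> 0"
    and "\<forall>j. std_dev_model (S j) (h j)"
    and "\<forall>j. \<sigma> $ j \<in> S j"
    and "x \<in> location_plans I p"
    and "\<forall>j. n $ j \<in> {0..b}"
    and "cost_ordering I c j \<pi>"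
    and "prob_space M"
    and "has_multivariate_normal_law M \<xi> \<mu> (demand_covariance h \<sigma> n)"
  shows "integrable M (\<lambda>\<omega>. recourse I c D j x (\<xi> \<omega> $ j)) \<and>
    prob_space.expectation M (\<lambda>\<omega>. recourse I c D j x (\<xi> \<omega> $ j)) =
      base_cost I c D j \<pi> x + c (\<pi> 0) j * \<mu> $ j
      + h j (n $ j) (\<sigma> $ j) *
        (\<Sum>k=1..card I. (c (\<pi> (k - 1)) j - c (\<pi> k) j) *
           normal_loss ((breakpoint I D j \<pi> x k - \<mu> $ j) / h j (n $ j) (\<sigma> $ j)))"
proof -
  interpret prob_space M by fact
  let ?\<tau> = "h j (n $ j) (\<sigma> $ j)" and ?B = "breakpoint I D j \<pi> x"
  let ?\<Delta> = "\<lambda>k. c (\<pi> (k - 1)) j - c (\<pi> k) j"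
  have "0 \<le> n $ j"
    using assms(8) by simp
  then have \<tau>: "0 < ?\<tau>"
    using assms(5,6) by (auto simp: std_dev_model_def)
  note law = demand_component_normal[OF assms(11) \<tau>]
  have int: "integrable M (\<lambda>\<omega>. \<xi> \<omega> $ j)"
    using distributed_integrable[OF law, of "\<lambda>t. t"] integrable_normal_moment_nz_1[OF \<tau>] by simp
  have exp: "expectation (\<lambda>\<omega>. \<xi> \<omega> $ j) = \<mu> $ j"
    by (rule normal_distributed_expectation[OF \<tau> law])
  have eq: "recourse I c D j x d = c (\<pi> 0) j * d - (\<Sum>k=1..card I. ?\<Delta> k * min (?B k) d)" for d
    using assms(1-4,7,9) by (intro recourse_eq_min_breakpoints) auto
  have "expectation (\<lambda>\<omega>. recourse I c D j x (\<xi> \<omega> $ j)) =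
      c (\<pi> 0) j * \<mu> $ j -
        (\<Sum>k=1..card I. ?\<Delta> k * (?B k - ?\<tau> * normal_loss ((?B k - \<mu> $ j) / ?\<tau>)))"
    unfolding eq using int normal_expected_min[OF law \<tau>] by (simp add: exp)
  also have "\<dots> = base_cost I c D j \<pi> x + c (\<pi> 0) j * \<mu> $ j
      + ?\<tau> * (\<Sum>k=1..card I. ?\<Delta> k * normal_loss ((?B k - \<mu> $ j) / ?\<tau>))"
    unfolding base_cost_eq_breakpoints
    by (simp add: right_diff_distrib sum_subtractf sum_distrib_left mult.left_commute)
  finally show ?thesis
    unfolding eq using int normal_expected_min(1)[OF law \<tau>] by simp
qed

end
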